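(* Let $m,n$ be positive integers, let $\sigma(1),\dots,\sigma(m)$ be i.i.d. random variables with values in $[n]=\{1,\dots,n\}$ (with an arbitrary common distribution), and let $t_1,\dots,t_n\in\mathbb N$. For $j\in[n]$ let $\mathbf x_j$ be the indicator of the event $\{|\sigma^{-1}(j)|\ge t_j\}$, where $\sigma^{-1}(j)=\{i\in[m]:\sigma(i)=j\}$. Then the law of $(\mathbf x_1,\dots,\mathbf x_n)$, a probability measure on $\{0,1\}^n$, is conditionally negatively associated.
   Context: $\mathbb N=\{0,1,2,\dots\}$, $[m]=\{1,\dots,m\}$. Let $\Omega=\prod_{i=1}^n\Omega_i$ be a finite product of finite chains (totally ordered sets), with the product order (here each $\Omega_i=\{0,1\}$). An event $\mathcal A\subseteq\Omega$ is increasing if $x\ge y\in\mathcal A$ implies $x\in\mathcal A$. A coordinate $i$ affects $\mathcal A$ if there are $\eta\in\mathcal A$ and $\tau\in\Omega\setminus\mathcal A$ with $\eta_j=\tau_j$ for all $j\ne i$; write $\mathcal A\perp\mathcal B$ if no coordinate affects both $\mathcal A$ and $\mathcal B$. A probability measure $\mu$ on $\Omega$ is negatively associated (NA) if $\mu(\mathcal A\cap\mathcal B)\le\mu(\mathcal A)\mu(\mathcal B)$ whenever $\mathcal A,\mathcal B$ are increasing and $\mathcal A\perp\mathcal B$. It is conditionally negatively associated (CNA) if every measure obtained from $\mu$ by conditioning on the values of some (possibly none) of the coordinate variables is NA; only conditioning events of positive probability are considered. *)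

theory Defs
  imports "HOL-Probability.Probability"
begin

text \<open>
  The product of the chains \<open>\<Omega> i\<close>, \<open>i \<in> I\<close>, is the set \<open>PiE I \<Omega>\<close>, where each \<open>\<Omega> i\<close> carries
  the order of the ambient linearly ordered type. It is intended for finite \<open>I\<close> and finite
  \<open>\<Omega> i\<close>, so that every subset of \<open>PiE I \<Omega>\<close> is an event.
\<close>

definition increasing_event :: "'i set \<Rightarrow> ('i \<Rightarrow> 'a::linorder set) \<Rightarrow> ('i \<Rightarrow> 'a) set \<Rightarrow> bool" where
  "increasing_event I \<Omega> A \<longleftrightarrow>
     A \<subseteq> PiE I \<Omega> \<and> (\<forall>x\<in>PiE I \<Omega>. \<forall>y\<in>A. (\<forall>i\<in>I. y i \<le> x i) \<longrightarrow> x \<in> A)"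

definition affects :: "'i set \<Rightarrow> ('i \<Rightarrow> 'a set) \<Rightarrow> 'i \<Rightarrow> ('i \<Rightarrow> 'a) set \<Rightarrow> bool" where
  "affects I \<Omega> i A \<longleftrightarrow> (\<exists>\<eta>\<in>A. \<exists>\<tau>\<in>PiE I \<Omega> - A. \<forall>j\<in>I - {i}. \<eta> j = \<tau> j)"

definition perp :: "'i set \<Rightarrow> ('i \<Rightarrow> 'a set) \<Rightarrow> ('i \<Rightarrow> 'a) set \<Rightarrow> ('i \<Rightarrow> 'a) set \<Rightarrow> bool" where
  "perp I \<Omega> A B \<longleftrightarrow> \<not> (\<exists>i\<in>I. affects I \<Omega> i A \<and> affects I \<Omega> i B)"

definition prob_measure_on :: "'b set \<Rightarrow> 'b measure \<Rightarrow> bool" where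
  "prob_measure_on X \<mu> \<longleftrightarrow> prob_space \<mu> \<and> sets \<mu> = Pow X"

definition negatively_associated ::
    "'i set \<Rightarrow> ('i \<Rightarrow> 'a::linorder set) \<Rightarrow> ('i \<Rightarrow> 'a) measure \<Rightarrow> bool" where
  "negatively_associated I \<Omega> \<mu> \<longleftrightarrow>
     prob_measure_on (PiE I \<Omega>) \<mu> \<and>
     (\<forall>A B. increasing_event I \<Omega> A \<and> increasing_event I \<Omega> B \<and> perp I \<Omega> A B \<longrightarrow>
        measure \<mu> (A \<inter> B) \<le> measure \<mu> A * measure \<mu> B)"

text \<open>
  Here \<open>uniform_measure \<mu> C\<close> is \<open>\<mu>\<close> conditioned on the event \<open>C\<close>, again a measure on the
  whole product; \<open>S\<close> is the set of coordinates whose values are prescribed.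
\<close>

definition conditionally_negatively_associated ::
    "'i set \<Rightarrow> ('i \<Rightarrow> 'a::linorder set) \<Rightarrow> ('i \<Rightarrow> 'a) measure \<Rightarrow> bool" where
  "conditionally_negatively_associated I \<Omega> \<mu> \<longleftrightarrow>
     prob_measure_on (PiE I \<Omega>) \<mu> \<and>
     (\<forall>S v. S \<subseteq> I \<and> v \<in> PiE S \<Omega> \<and> measure \<mu> {x \<in> PiE I \<Omega>. \<forall>i\<in>S. x i = v i} > 0 \<longrightarrow>
        negatively_associated I \<Omega> (uniform_measure \<mu> {x \<in> PiE I \<Omega>. \<forall>i\<in>S. x i = v i}))"

end

theory Submission
  imports Defs
begin

text \<open>
  The occupancy counts have the law of independent Poisson variables conditioned on their sum
  being \<open>m\<close>. Prescribing some of the threshold indicators restricts some of the counts to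
  an initial or a final segment of the naturals, so the weights stay log-concave. Split the
  coordinates into those that affect \<open>B\<close> and the rest: given the total \<open>s\<close> on the rest, the two
  events are independent; by Efron's theorem the conditional probability of \<open>A\<close> is increasing
  in \<open>s\<close> and that of \<open>B\<close>, whose coordinates have total \<open>m - s\<close>, is decreasing in \<open>s\<close>.
  Chebyshev's inequality then gives the negative correlation. To avoid dividing by vanishing
  probabilities, all comparisons of conditional expectations are stated cross-multiplied.
\<close>

subsection \<open>Log-concave sequences\<close>

text \<open>Summed over all pairs, the products of 2x2 minors expand to twice the difference of the
  two sides (Cauchy-Binet). Each product is symmetric in \<open>i\<close> and \<open>j\<close>, so
  ordered pairs suffice. The lemma serves both for total positivity and as Chebyshev's
  inequality.\<close>

lemma cauchy_binet_le:
  fixes a b c d :: "'i::linorder \<Rightarrow> real"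
  assumes "finite N"
    and "\<And>i j. i \<in> N \<Longrightarrow> j \<in> N \<Longrightarrow> i \<le> j \<Longrightarrow> (a i * b j - a j * b i) * (c i * d j - c j * d i) \<ge> 0"
  shows "(\<Sum>i\<in>N. a i * d i) * (\<Sum>i\<in>N. b i * c i) \<le> (\<Sum>i\<in>N. a i * c i) * (\<Sum>i\<in>N. b i * d i)"
proof -
  have nonneg: "(a i * b j - a j * b i) * (c i * d j - c j * d i) \<ge> 0" if "i \<in> N" "j \<in> N" for i j
  proof (cases "i \<le> j")
    case False
    then have "(a j * b i - a i * b j) * (c j * d i - c i * d j) \<ge> 0"
      using assms(2)[of j i] that by simp
    then show ?thesis by (simp add: algebra_simps)
  qed (use assms that in auto)
  have "0 \<le> (\<Sum>i\<in>N. \<Sum>j\<in>N. (a i * b j - a j * b i) * (c i * d j - c j * d i))"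
    by (intro sum_nonneg nonneg)
  also have "\<dots> = (\<Sum>i\<in>N. \<Sum>j\<in>N. a i * c i * (b j * d j)) - (\<Sum>i\<in>N. \<Sum>j\<in>N. a i * d i * (b j * c j))
      - (\<Sum>i\<in>N. \<Sum>j\<in>N. b i * c i * (a j * d j)) + (\<Sum>i\<in>N. \<Sum>j\<in>N. b i * d i * (a j * c j))"
    by (simp add: algebra_simps sum.distrib sum_subtractf)
  also have "\<dots> = 2 * ((\<Sum>i\<in>N. a i * c i) * (\<Sum>i\<in>N. b i * d i)
      - (\<Sum>i\<in>N. a i * d i) * (\<Sum>i\<in>N. b i * c i))"
    by (simp add: sum_product[symmetric])
  finally show ?thesis by simp
qed

text \<open>The gap \<open>c\<close> is arbitrary, unlike in the usual inequality for three
  consecutive terms; this rules out internal zeros of the support.\<close>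

definition log_concave :: "(nat \<Rightarrow> real) \<Rightarrow> bool" where
  "log_concave w \<longleftrightarrow> (\<forall>a. 0 \<le> w a) \<and> (\<forall>a b c. a \<le> b \<longrightarrow> w a * w (b + c) \<le> w (a + c) * w b)"

lemma log_concave_nonneg: "log_concave w \<Longrightarrow> 0 \<le> w a"
  by (simp add: log_concave_def)

text \<open>The Toeplitz matrix of \<open>w\<close>. The zero is explicit because truncated
  subtraction would give \<open>w 0\<close> for \<open>i > s\<close>.\<close>

definition kern :: "(nat \<Rightarrow> real) \<Rightarrow> nat \<Rightarrow> nat \<Rightarrow> real" where
  "kern w s i = (if i \<le> s then w (s - i) else 0)"

lemma kern_nonneg: "log_concave w \<Longrightarrow> 0 \<le> kern w s i"
  by (simp add: kern_def log_concave_nonneg)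

text \<open>Log-concavity of \<open>w\<close>, read as total positivity of order 2. If
  \<open>i' > s\<close>, the left side vanishes.\<close>

lemma kern_TP2:
  assumes "log_concave w" "s \<le> s'" "i \<le> i'"
  shows "kern w s i' * kern w s' i \<le> kern w s i * kern w s' i'"
proof (cases "i' \<le> s")
  case True
  have "w (s - i') * w ((s' - i') + (i' - i)) \<le> w ((s - i') + (i' - i)) * w (s' - i')"
    using assms unfolding log_concave_def by (meson diff_le_mono)
  then show ?thesis using True assms by (simp add: kern_def)
qed (use assms in \<open>auto simp: kern_def log_concave_nonneg\<close>)

definition conv :: "(nat \<Rightarrow> real) \<Rightarrow> (nat \<Rightarrow> real) \<Rightarrow> nat \<Rightarrow> real" where
  "conv w v s = (\<Sum>a\<le>s. w a * v (s - a))"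

text \<open>The product of two Toeplitz matrices is the Toeplitz matrix of the convolution. The
  bound \<open>n\<close> gives sums for different \<open>s\<close> a common index set.\<close>

lemma sum_kern_mult:
  assumes "c \<le> s" "s \<le> n"
  shows "(\<Sum>i\<le>n. kern v s i * kern w i c) = conv w v (s - c)"
proof -
  have "(\<Sum>i\<le>n. kern v s i * kern w i c) = (\<Sum>i\<in>{c..s}. v (s - i) * w (i - c))"
    using assms by (intro sum.mono_neutral_cong_right) (auto simp: kern_def)
  also have "\<dots> = (\<Sum>a\<le>s - c. w a * v (s - c - a))"
    using assms
    by (intro sum.reindex_bij_witness[of _ "\<lambda>a. a + c" "\<lambda>i. i - c"]) (auto simp: mult.commute)
  finally show ?thesis by (simp add: conv_def)
qed

lemma log_concave_conv:
  assumes w: "log_concave w" and v: "log_concave v"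
  shows "log_concave (conv w v)"
  unfolding log_concave_def
proof (intro conjI allI impI)
  show "0 \<le> conv w v a" for a
    unfolding conv_def by (intro sum_nonneg mult_nonneg_nonneg log_concave_nonneg w v)
  fix a b c :: nat assume "a \<le> b"
  \<comment> \<open>Rows \<open>a + c\<close>, \<open>b + c\<close> and columns \<open>0\<close>,
    \<open>c\<close> of the matrix product hold the four convolution values; its minor is a sum of
    products of nonnegative minors.\<close>
  have "(\<Sum>i\<le>b + c. kern v (a + c) i * kern w i c) * (\<Sum>i\<le>b + c. kern v (b + c) i * kern w i 0)
     \<le> (\<Sum>i\<le>b + c. kern v (a + c) i * kern w i 0) * (\<Sum>i\<le>b + c. kern v (b + c) i * kern w i c)"
  proof (rule cauchy_binet_le, simp, rule mult_nonneg_nonneg)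
    fix i j :: nat assume "i \<le> j"
    show "0 \<le> kern v (a + c) i * kern v (b + c) j - kern v (a + c) j * kern v (b + c) i"
      using kern_TP2[OF v, of "a + c" "b + c" i j] \<open>i \<le> j\<close> \<open>a \<le> b\<close> by simp
    show "0 \<le> kern w i 0 * kern w j c - kern w j 0 * kern w i c"
      using kern_TP2[OF w \<open>i \<le> j\<close>, of 0 c] by (simp add: mult.commute)
  qed
  then show "conv w v a * conv w v (b + c) \<le> conv w v (a + c) * conv w v b"
    using \<open>a \<le> b\<close> by (simp add: sum_kern_mult)
qed

text \<open>These are Poisson weights up to normalisation. The powers of \<open>p\<close> on both
  sides agree, which leaves an inequality between factorials.\<close>

lemma log_concave_exp_weight:
  fixes p :: real
  assumes "0 \<le> p"
  shows "log_concave (\<lambda>a. p ^ a / fact a)"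
  unfolding log_concave_def
proof (intro conjI allI impI)
  show "0 \<le> p ^ a / fact a" for a using assms by simp
  fix a b c :: nat assume "a \<le> b"
  have fact_le: "fact (a + c) * fact b \<le> (fact a * fact (b + c) :: real)"
  proof (induction c)
    case (Suc c)
    have "real (Suc (a + c)) * (fact (a + c) * fact b) \<le> real (Suc (b + c)) * (fact a * fact (b + c))"
      using \<open>a \<le> b\<close> by (intro mult_mono Suc) auto
    then show ?case by (simp add: algebra_simps)
  qed simp
  have "p ^ (a + b + c) / (fact a * fact (b + c)) \<le> p ^ (a + b + c) / (fact (a + c) * fact b)"
    using assms by (intro divide_left_mono fact_le) auto
  then show "p ^ a / fact a * (p ^ (b + c) / fact (b + c)) \<le> p ^ (a + c) / fact (a + c) * (p ^ b / fact b)"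
    by (simp add: power_add mult_ac)
qed

text \<open>Both \<open>a + c\<close> and \<open>b\<close> lie between \<open>a\<close> and
  \<open>b + c\<close>, so \<open>Q\<close> holds there whenever the left side is nonzero.
  Conditioning on threshold indicators restricts weights in this way.\<close>

lemma log_concave_restrict:
  assumes w: "log_concave w"
    and convex: "\<And>a b c. a \<le> b \<Longrightarrow> b \<le> c \<Longrightarrow> Q a \<Longrightarrow> Q c \<Longrightarrow> Q b"
  shows "log_concave (\<lambda>a. w a * of_bool (Q a))"
  unfolding log_concave_def
proof (intro conjI allI impI)
  show "0 \<le> w a * of_bool (Q a)" for a using log_concave_nonneg[OF w] by simp
  fix a b c :: nat assume "a \<le> b"
  show "w a * of_bool (Q a) * (w (b + c) * of_bool (Q (b + c)))
      \<le> w (a + c) * of_bool (Q (a + c)) * (w b * of_bool (Q b))"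
  proof (cases "Q a \<and> Q (b + c)")
    case True
    then have "Q (a + c)" "Q b"
      using convex[of a "a + c" "b + c"] convex[of a b "b + c"] \<open>a \<le> b\<close> by auto
    then show ?thesis using True w \<open>a \<le> b\<close> by (simp add: log_concave_def)
  qed (auto simp: log_concave_nonneg[OF w])
qed

subsection \<open>Efron's theorem\<close>

text \<open>
  The unnormalised masses \<open>P\<close> and \<open>Q\<close> are coupled so that each atom \<open>i\<close> of \<open>P\<close> is sent to
  \<open>i\<close> or \<open>i + 1\<close>; \<open>M (i + 1)\<close> is the mass moving from \<open>i\<close> to \<open>i + 1\<close>.
\<close>

lemma coupling_sum_le:
  fixes P Q g h :: "nat \<Rightarrow> real" and N :: nat
  defines "Pt \<equiv> (\<Sum>i<N. P i)" and "Qt \<equiv> (\<Sum>i<N. Q i)"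
  assumes P: "\<And>i. 0 \<le> P i" and Q: "\<And>i. 0 \<le> Q i"
    and M_nonneg: "\<And>i. i \<le> N \<Longrightarrow> Pt * (\<Sum>j<i. Q j) \<le> Qt * (\<Sum>j<i. P j)"
    and stay_nonneg: "\<And>i. i < N \<Longrightarrow> Qt * (\<Sum>j<i. P j) \<le> Pt * (\<Sum>j<Suc i. Q j)"
    and stay: "\<And>i. i < N \<Longrightarrow> 0 < P i \<Longrightarrow> 0 < Q i \<Longrightarrow> g i \<le> h i"
    and move: "\<And>i. Suc i < N \<Longrightarrow> 0 < P i \<Longrightarrow> 0 < Q (Suc i) \<Longrightarrow> g i \<le> h (Suc i)"
  shows "(\<Sum>i<N. P i * g i) * Qt \<le> (\<Sum>i<N. Q i * h i) * Pt"
proof -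
  define M where "M i = Qt * (\<Sum>j<i. P j) - Pt * (\<Sum>j<i. Q j)" for i
  \<comment> \<open>In the coupling of \<open>Qt * P\<close> with \<open>Pt * Q\<close>, both of
    total mass \<open>Pt * Qt\<close>, this is the mass that stays at \<open>i\<close>.\<close>
  define S where "S i = Pt * Q i - M i" for i
  have M: "0 \<le> M i" if "i \<le> N" for i using M_nonneg[OF that] by (simp add: M_def)
  have S: "0 \<le> S i" if "i < N" for i
    using stay_nonneg[OF that] by (simp add: S_def M_def algebra_simps)
  have SM: "S i + M (Suc i) = Qt * P i" for i by (simp add: S_def M_def algebra_simps)
  have M_ends: "M 0 = 0" "M N = 0" by (simp_all add: M_def Pt_def Qt_def)
  have Pt: "0 \<le> Pt" and Qt: "0 \<le> Qt" by (simp_all add: Pt_def Qt_def P Q sum_nonneg)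
  have pos: "0 < x" if "0 < c * x" "0 \<le> c" for c x :: real
    using that zero_less_mult_pos by (metis less_eq_real_def mult_zero_left less_irrefl)
  \<comment> \<open>A part of the split atom that is positive forces its source and target atoms to
    be positive, as \<open>stay\<close> and \<open>move\<close> demand.\<close>
  have atom: "Qt * P i * g i \<le> S i * h i + M (Suc i) * h (Suc i)" if i: "i < N" for i
  proof -
    have "S i * g i \<le> S i * h i"
    proof (cases "S i = 0")
      case False
      then have "0 < S i" using S[OF i] by simp
      moreover have "0 \<le> M i" "0 \<le> M (Suc i)" using M i by simp_all
      ultimately have "0 < Qt * P i" "0 < Pt * Q i"
        using SM[of i] S_def[of i] by linarith+
      then have "g i \<le> h i" using pos[OF _ Qt] pos[OF _ Pt] stay[OF i] by blast
      then show ?thesis using \<open>0 < S i\<close> by simp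
    qed simp
    moreover have "M (Suc i) * g i \<le> M (Suc i) * h (Suc i)"
    proof (cases "M (Suc i) = 0")
      case False
      \<comment> \<open>Since \<open>M N = 0\<close>, mass moves only to targets below
        \<open>N\<close>.\<close>
      then have *: "0 < M (Suc i)" "Suc i < N"
        using M[of "Suc i"] M_ends i by (auto simp: less_le Suc_le_eq)
      moreover have "0 \<le> S i" "0 \<le> S (Suc i)" using S i * by simp_all
      ultimately have "0 < Qt * P i" "0 < Pt * Q (Suc i)"
        using SM[of i] S_def[of "Suc i"] by linarith+
      then have "g i \<le> h (Suc i)" using pos[OF _ Qt] pos[OF _ Pt] move * by blast
      then show ?thesis using * by simp
    qed simp
    moreover have "Qt * P i * g i = S i * g i + M (Suc i) * g i"
      by (simp flip: SM add: algebra_simps)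
    ultimately show ?thesis by linarith
  qed
  have shift: "(\<Sum>i<N. M (Suc i) * h (Suc i)) = (\<Sum>i<N. M i * h i)"
    using sum.lessThan_Suc_shift[of "\<lambda>i. M i * h i" N] M_ends by simp
  have "(\<Sum>i<N. P i * g i) * Qt = (\<Sum>i<N. Qt * P i * g i)"
    by (simp add: sum_distrib_left mult_ac)
  also have "\<dots> \<le> (\<Sum>i<N. S i * h i + M (Suc i) * h (Suc i))"
    by (intro sum_mono) (simp add: atom)
  also have "\<dots> = (\<Sum>i<N. S i * h i + M i * h i)" by (simp add: sum.distrib shift)
  also have "\<dots> = (\<Sum>i<N. Q i * h i) * Pt"
    by (simp add: S_def algebra_simps sum_distrib_left)
  finally show ?thesis .
qed

lemma sum_indicator_lessThan:
  fixes f :: "nat \<Rightarrow> real"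
  assumes "i \<le> n"
  shows "(\<Sum>j<n. of_bool (j < i) * f j) = (\<Sum>j<i. f j)"
  using assms by (intro sum.mono_neutral_cong_right) auto

text \<open>Likelihood ratio order implies stochastic order: pair the ratio of \<open>Q\<close> to
  \<open>P\<close> with the decreasing indicator of an initial segment.\<close>

lemma partial_sum_le:
  fixes P Q :: "nat \<Rightarrow> real"
  assumes "i \<le> n" and lr: "\<And>j k. j \<le> k \<Longrightarrow> k < n \<Longrightarrow> P k * Q j \<le> P j * Q k"
  shows "(\<Sum>j<i. Q j) * (\<Sum>j<n. P j) \<le> (\<Sum>j<i. P j) * (\<Sum>j<n. Q j)"
proof -
  have "(\<Sum>j<n. of_bool (j < i) * Q j) * (\<Sum>j<n. 1 * P j)
     \<le> (\<Sum>j<n. of_bool (j < i) * P j) * (\<Sum>j<n. 1 * Q j)"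
    by (rule cauchy_binet_le) (auto simp: of_bool_def lr)
  then show ?thesis by (simp add: sum_indicator_lessThan[OF assms(1)])
qed

text \<open>The induction step of Efron's theorem. Here \<open>G a b / v b\<close> stands for a
  conditional expectation given first coordinate \<open>a\<close> and total \<open>b\<close> of the
  rest. When the overall total grows by one, the coupling raises either the rest
  (\<open>incr_b\<close>) or the first coordinate (\<open>incr_a\<close>).\<close>

lemma conv_sum_step:
  fixes G :: "nat \<Rightarrow> nat \<Rightarrow> real"
  assumes w: "log_concave w" and v: "log_concave v"
    and null: "\<And>a b. v b = 0 \<Longrightarrow> G a b = 0"
    and incr_a: "\<And>a b. G a b \<le> G (Suc a) b"
    and incr_b: "\<And>a b. G a b * v (Suc b) \<le> G a (Suc b) * v b"
  shows "(\<Sum>a\<le>s. w a * G a (s - a)) * conv w v (Suc s)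
       \<le> (\<Sum>a\<le>Suc s. w a * G a (Suc s - a)) * conv w v s"
proof -
  define P where "P i = w i * kern v s i" for i
  define Q where "Q i = w i * kern v (Suc s) i" for i
  \<comment> \<open>Where \<open>v\<close> vanishes, the quotient is 0 and so is \<open>G\<close> by
    \<open>null\<close>; hence \<open>P i * g i\<close> is the intended term in every case.\<close>
  define g where "g i = G i (s - i) / v (s - i)" for i
  define h where "h i = G i (Suc s - i) / v (Suc s - i)" for i
  \<comment> \<open>The range \<open>0..s + 1\<close> covers the support of \<open>Q\<close>;
    \<open>P\<close> vanishes at its last point.\<close>
  define N where "N = Suc (Suc s)"
  have w0: "0 \<le> w i" and v0: "0 \<le> v i" for i
    using w v by (simp_all add: log_concave_nonneg)
  have P0: "0 \<le> P i" and Q0: "0 \<le> Q i" for i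
    by (simp_all add: P_def Q_def w0 kern_nonneg[OF v])
  have Ps: "P (Suc s) = 0" by (simp add: P_def kern_def)
  have Pt: "(\<Sum>i<N. P i) = conv w v s"
    by (simp add: N_def Ps lessThan_Suc_atMost conv_def del: sum.lessThan_Suc)
       (simp add: P_def kern_def)
  have Qt: "(\<Sum>i<N. Q i) = conv w v (Suc s)"
    by (simp add: N_def lessThan_Suc_atMost conv_def del: sum.lessThan_Suc sum.atMost_Suc)
       (simp add: Q_def kern_def del: sum.atMost_Suc)
  have Pg: "(\<Sum>i<N. P i * g i) = (\<Sum>a\<le>s. w a * G a (s - a))"
  proof -
    have "(\<Sum>i<N. P i * g i) = (\<Sum>i\<le>s. P i * g i)"
      by (simp add: N_def Ps lessThan_Suc_atMost[symmetric])
    also have "\<dots> = (\<Sum>a\<le>s. w a * G a (s - a))"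
      by (intro sum.cong refl) (auto simp: P_def g_def kern_def null)
    finally show ?thesis .
  qed
  have Qh: "(\<Sum>i<N. Q i * h i) = (\<Sum>a\<le>Suc s. w a * G a (Suc s - a))"
    unfolding N_def lessThan_Suc_atMost
    by (intro sum.cong refl) (auto simp: Q_def h_def kern_def null)
  have M: "(\<Sum>j<i. Q j) * (\<Sum>j<N. P j) \<le> (\<Sum>j<i. P j) * (\<Sum>j<N. Q j)" if "i \<le> N" for i
  proof (rule partial_sum_le[OF that])
    fix j k :: nat assume "j \<le> k"
    have "w j * w k * (kern v s k * kern v (Suc s) j) \<le> w j * w k * (kern v s j * kern v (Suc s) k)"
      by (intro mult_left_mono kern_TP2[OF v _ \<open>j \<le> k\<close>]) (simp_all add: w0)
    then show "P k * Q j \<le> P j * Q k" by (simp add: P_def Q_def mult_ac)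
  qed
  \<comment> \<open>This is \<open>P\<close> shifted up by one place, with \<open>P' 0 = 0\<close>.
    Log-concavity of \<open>w\<close> puts \<open>Q\<close> below \<open>P'\<close> in likelihood
    ratio order, so no mass has to move more than one place.\<close>
  define P' where "P' i = kern w i 1 * kern v (Suc s) i" for i
  have P'_Suc: "(\<Sum>j<Suc i. P' j) = (\<Sum>j<i. P j)" for i
    by (simp only: sum.lessThan_Suc_shift) (auto simp: P'_def P_def kern_def intro!: sum.cong)
  have P'_N: "(\<Sum>j<N. P' j) = (\<Sum>j<N. P j)"
    unfolding N_def by (subst P'_Suc) (simp add: Ps)
  have S: "(\<Sum>j<i. P' j) * (\<Sum>j<N. Q j) \<le> (\<Sum>j<i. Q j) * (\<Sum>j<N. P' j)" if "i \<le> N" for i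
  proof (rule partial_sum_le[OF that])
    fix j k :: nat assume "j \<le> k"
    have "kern v (Suc s) j * kern v (Suc s) k * (kern w j 1 * kern w k 0)
        \<le> kern v (Suc s) j * kern v (Suc s) k * (kern w j 0 * kern w k 1)"
      by (intro mult_left_mono kern_TP2[OF w \<open>j \<le> k\<close>]) (simp_all add: kern_nonneg[OF v])
    then show "Q k * P' j \<le> Q j * P' k" by (simp add: P'_def Q_def kern_def mult_ac)
  qed
  have "(\<Sum>i<N. P i * g i) * (\<Sum>i<N. Q i) \<le> (\<Sum>i<N. Q i * h i) * (\<Sum>i<N. P i)"
  proof (rule coupling_sum_le[OF P0 Q0])
    show "(\<Sum>i<N. P i) * (\<Sum>j<i. Q j) \<le> (\<Sum>i<N. Q i) * (\<Sum>j<i. P j)" if "i \<le> N" for i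
      using M[OF that] by (simp add: mult.commute)
    show "(\<Sum>i<N. Q i) * (\<Sum>j<i. P j) \<le> (\<Sum>i<N. P i) * (\<Sum>j<Suc i. Q j)" if "i < N" for i
      using S[of "Suc i"] that by (simp only: P'_N P'_Suc Suc_le_eq) (simp add: mult.commute)
    show "g i \<le> h i" if "0 < P i" "0 < Q i" for i
    proof -
      have "i \<le> s" using that by (auto simp: P_def kern_def split: if_splits)
      with that have "0 < v (s - i)" "0 < v (Suc s - i)"
        using w0[of i] v0[of "s - i"] v0[of "Suc s - i"]
        by (auto simp: P_def Q_def kern_def less_le)
      then show ?thesis
        using incr_b[of i "s - i"] \<open>i \<le> s\<close> by (simp add: g_def h_def Suc_diff_le field_simps)
    qed
    \<comment> \<open>Both quotients have the denominator \<open>v (s - i)\<close>.\<close>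
    show "g i \<le> h (Suc i)" for i
      by (simp add: g_def h_def divide_right_mono incr_a v0)
  qed
  then show ?thesis by (simp only: Pg Qh Pt Qt)
qed

section \<open>Weighted sums over vectors with a given total\<close>

primrec weight :: "('i \<Rightarrow> nat \<Rightarrow> real) \<Rightarrow> 'i list \<Rightarrow> nat \<Rightarrow> real" where
  "weight w [] = (\<lambda>s. of_bool (s = 0))"
| "weight w (i # L) = conv (w i) (weight w L)"

text \<open>
  \<open>comp_sum w L f s k\<close> is the sum of \<open>f k' * (\<Prod>i\<in>set L. w i (k' i))\<close> over all \<open>k'\<close> that agree
  with \<open>k\<close> outside \<open>set L\<close> and have total \<open>s\<close> on \<open>L\<close>, provided that \<open>L\<close> is distinct.
\<close>

primrec comp_sum ::
    "('i \<Rightarrow> nat \<Rightarrow> real) \<Rightarrow> 'i list \<Rightarrow> (('i \<Rightarrow> nat) \<Rightarrow> real) \<Rightarrow> nat \<Rightarrow> ('i \<Rightarrow> nat) \<Rightarrow> real" where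
  "comp_sum w [] f s k = of_bool (s = 0) * f k"
| "comp_sum w (i # L) f s k = (\<Sum>a\<le>s. w i a * comp_sum w L f (s - a) (k(i := a)))"

definition unaffected :: "(('i \<Rightarrow> nat) \<Rightarrow> real) \<Rightarrow> 'i \<Rightarrow> bool" where
  "unaffected f i \<longleftrightarrow> (\<forall>k a. f (k(i := a)) = f k)"

lemma unaffected_upd: "unaffected f i \<Longrightarrow> f (k(i := a)) = f k"
  by (simp add: unaffected_def)

lemma log_concave_weight:
  "(\<And>i. i \<in> set L \<Longrightarrow> log_concave (w i)) \<Longrightarrow> log_concave (weight w L)"
proof (induction L)
  case Nil
  show ?case by (auto simp: log_concave_def)
qed (simp add: log_concave_conv)

lemma comp_sum_const: "comp_sum w L (\<lambda>_. 1) s k = weight w L s"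
  by (induction L arbitrary: s k) (simp_all add: conv_def)

lemma comp_sum_nonneg:
  "(\<And>i a. i \<in> set L \<Longrightarrow> 0 \<le> w i a) \<Longrightarrow> (\<And>k. 0 \<le> f k) \<Longrightarrow> 0 \<le> comp_sum w L f s k"
  by (induction L arbitrary: s k) (auto intro!: sum_nonneg mult_nonneg_nonneg)

lemma comp_sum_mono:
  assumes "\<And>i a. i \<in> set L \<Longrightarrow> 0 \<le> w i a" and "mono f" "k \<le> k'"
  shows "comp_sum w L f s k \<le> comp_sum w L f s k'"
  using assms(1,3)
proof (induction L arbitrary: s k k')
  case Nil
  then show ?case using \<open>mono f\<close> by (simp add: monoD)
next
  case (Cons i L)
  then show ?case
    by (auto intro!: sum_mono mult_left_mono Cons.IH simp: le_fun_def)
qed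

text \<open>The nonnegative terms of a vanishing convolution all vanish. This supplies the
  hypothesis \<open>null\<close> of \<open>conv_sum_step\<close>.\<close>

lemma comp_sum_eq_0:
  assumes "\<And>i. i \<in> set L \<Longrightarrow> log_concave (w i)" "weight w L s = 0"
  shows "comp_sum w L f s k = 0"
  using assms
proof (induction L arbitrary: s k)
  case (Cons i L)
  have "log_concave (weight w L)" "log_concave (w i)"
    using Cons.prems by (simp_all add: log_concave_weight)
  then have "\<forall>a\<in>{..s}. w i a * weight w L (s - a) = 0"
    using Cons.prems(2)
    by (subst (asm) weight.simps, subst (asm) conv_def, subst (asm) sum_nonneg_eq_0_iff)
      (auto intro!: mult_nonneg_nonneg simp: log_concave_nonneg)
  then show ?case
    using Cons.IH Cons.prems(1) by (auto intro!: sum.neutral)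
qed simp

text \<open>Induction on \<open>L\<close>: monotonicity of \<open>f\<close> handles a larger first
  coordinate, the induction hypothesis a larger total of the rest.\<close>

lemma comp_sum_step:
  assumes "\<And>i. i \<in> set L \<Longrightarrow> log_concave (w i)" and "mono f"
  shows "comp_sum w L f s k * weight w L (Suc s) \<le> comp_sum w L f (Suc s) k * weight w L s"
  using assms(1)
proof (induction L arbitrary: s k)
  case (Cons i L)
  have lc: "log_concave (w i)" "log_concave (weight w L)"
    using Cons.prems by (simp_all add: log_concave_weight)
  have "(\<Sum>a\<le>s. w i a * comp_sum w L f (s - a) (k(i := a))) * conv (w i) (weight w L) (Suc s)
     \<le> (\<Sum>a\<le>Suc s. w i a * comp_sum w L f (Suc s - a) (k(i := a))) * conv (w i) (weight w L) s"
  proof (rule conv_sum_step[OF lc, where G = "\<lambda>a b. comp_sum w L f b (k(i := a))"])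
    show "comp_sum w L f b (k(i := a)) = 0" if "weight w L b = 0" for a b
      using comp_sum_eq_0 Cons.prems that by (metis list.set_intros(2))
    show "comp_sum w L f b (k(i := a)) \<le> comp_sum w L f b (k(i := Suc a))" for a b
      using Cons.prems \<open>mono f\<close>
      by (intro comp_sum_mono) (auto simp: log_concave_nonneg le_fun_def)
    show "comp_sum w L f b (k(i := a)) * weight w L (Suc b)
        \<le> comp_sum w L f (Suc b) (k(i := a)) * weight w L b" for a b
      using Cons by simp
  qed
  then show ?case by simp
qed simp

text \<open>
  Efron's theorem: conditionally on its total, a vector of independent log-concave variables
  gives increasing functions an expectation that increases with the total.
\<close>

lemma comp_sum_weight_le:
  assumes lc: "\<And>i. i \<in> set L \<Longrightarrow> log_concave (w i)" and f: "mono f" "\<And>k. 0 \<le> f k"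
    and "s \<le> s'"
  shows "comp_sum w L f s k * weight w L s' \<le> comp_sum w L f s' k * weight w L s"
  using \<open>s \<le> s'\<close>
proof (induction s' rule: dec_induct)
  case (step r)
  let ?F = "\<lambda>s. comp_sum w L f s k" and ?W = "weight w L"
  have W: "log_concave ?W" by (simp add: log_concave_weight lc)
  then have W0: "0 \<le> ?W b" for b by (rule log_concave_nonneg)
  show ?case
  proof (cases "?W r = 0")
    \<comment> \<open>Here \<open>?W r\<close> cannot be cancelled, but log-concavity of
      \<open>?W\<close> makes \<open>?W s\<close> or \<open>?W (Suc r)\<close> vanish, so the left
      side is 0.\<close>
    case True
    have "?W s * ?W (r + 1) \<le> ?W (s + 1) * ?W r"
      using W step.hyps unfolding log_concave_def by blast
    then have "?W s * ?W (Suc r) = 0"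
      using True W0[of s] W0[of "Suc r"] by (auto simp: mult_le_0_iff)
    then have "?F s * ?W (Suc r) = 0"
      using comp_sum_eq_0[of L w s] lc by auto
    moreover have "0 \<le> ?F (Suc r) * ?W s"
      by (intro mult_nonneg_nonneg comp_sum_nonneg log_concave_nonneg lc f W0)
    ultimately show ?thesis by linarith
  next
    case False
    then have "0 < ?W r" using W0[of r] by simp
    have "?W r * (?F s * ?W (Suc r)) \<le> ?F r * ?W s * ?W (Suc r)"
      using mult_right_mono[OF step.IH W0[of "Suc r"]] by (simp add: mult_ac)
    also have "\<dots> = (?F r * ?W (Suc r)) * ?W s" by simp
    also have "\<dots> \<le> (?F (Suc r) * ?W r) * ?W s"
      by (intro mult_right_mono W0 comp_sum_step lc f)
    finally have "?W r * (?F s * ?W (Suc r)) \<le> ?W r * (?F (Suc r) * ?W s)"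
      by (simp add: mult_ac)
    with \<open>0 < ?W r\<close> show ?thesis by (simp only: mult_le_cancel_left_pos)
  qed
qed simp

lemma comp_sum_unaffected:
  "unaffected g i \<Longrightarrow> comp_sum w L g s (k(i := a)) = comp_sum w L g s k"
proof (induction L arbitrary: s k)
  case (Cons j L)
  then have "comp_sum w L g r (k(i := a, j := b)) = comp_sum w L g r (k(j := b))" for r b
    by (cases "i = j") (simp_all add: fun_upd_twist[of i j] del: fun_upd_apply)
  then show ?case by (simp del: fun_upd_apply)
qed (simp add: unaffected_upd)

lemma comp_sum_factor:
  assumes "\<And>i. i \<in> set L \<Longrightarrow> unaffected f i"
  shows "comp_sum w L (\<lambda>k. f k * g k) s k = f k * comp_sum w L g s k"
  using assms
  by (induction L arbitrary: s k) (simp_all add: unaffected_upd sum_distrib_left mult_ac)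

text \<open>Given the total \<open>s\<close> on \<open>L1\<close>, the sum factorises, as
  \<open>g\<close> ignores \<open>L1\<close> and \<open>f\<close> ignores \<open>L2\<close>:
  conditional independence.\<close>

lemma comp_sum_append:
  assumes "\<And>i. i \<in> set L1 \<Longrightarrow> unaffected g i" "\<And>i. i \<in> set L2 \<Longrightarrow> unaffected f i"
  shows "comp_sum w (L1 @ L2) (\<lambda>k. f k * g k) m k
       = (\<Sum>s\<le>m. comp_sum w L1 f s k * comp_sum w L2 g (m - s) k)"
  using assms(1)
proof (induction L1 arbitrary: m k)
  case Nil
  have "(\<Sum>s\<le>m. of_bool (s = 0) * f k * comp_sum w L2 g (m - s) k)
      = (\<Sum>s\<in>{0}. of_bool (s = 0) * f k * comp_sum w L2 g (m - s) k)"
    by (intro sum.mono_neutral_right) auto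
  then show ?case using comp_sum_factor[OF assms(2)] by simp
next
  case (Cons i L1)
  let ?c = "\<lambda>a s. w i a * comp_sum w L1 f s (k(i := a)) * comp_sum w L2 g (m - (a + s)) k"
  have "comp_sum w ((i # L1) @ L2) (\<lambda>k. f k * g k) m k
      = (\<Sum>a\<le>m. w i a * (\<Sum>s\<le>m - a. comp_sum w L1 f s (k(i := a)) * comp_sum w L2 g (m - a - s) (k(i := a))))"
    using Cons by simp
  also have "\<dots> = (\<Sum>a\<le>m. \<Sum>s\<le>m - a. ?c a s)"
    using Cons.prems by (simp add: comp_sum_unaffected sum_distrib_left mult_ac)
  also have "\<dots> = (\<Sum>(a, s)\<in>{(a, s). a + s \<le> m}. ?c a s)"
  proof -
    have "{(a, s). a + s \<le> m} = (SIGMA a:{..m}. {..m - a})" by auto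
    then show ?thesis by (simp add: sum.Sigma)
  qed
  \<comment> \<open>The pairs are regrouped by \<open>r = a + s\<close>, the total on
    \<open>i # L1\<close>.\<close>
  also have "\<dots> = (\<Sum>r\<le>m. \<Sum>a\<le>r. ?c a (r - a))"
    by (rule sum.triangle_reindex_eq)
  also have "\<dots> = (\<Sum>r\<le>m. comp_sum w (i # L1) f r k * comp_sum w L2 g (m - r) k)"
    by (simp add: sum_distrib_right)
  finally show ?case .
qed

section \<open>Negative correlation given the total\<close>

lemma comp_sum_neg_corr:
  assumes lc: "\<And>i. i \<in> set (L1 @ L2) \<Longrightarrow> log_concave (w i)"
    and f: "mono f" "\<And>k. 0 \<le> f k" and g: "mono g" "\<And>k. 0 \<le> g k"
    and disj: "\<And>i. i \<in> set L1 \<Longrightarrow> unaffected g i" "\<And>i. i \<in> set L2 \<Longrightarrow> unaffected f i"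
  shows "comp_sum w (L1 @ L2) (\<lambda>k. f k * g k) m k * weight w (L1 @ L2) m
       \<le> comp_sum w (L1 @ L2) f m k * comp_sum w (L1 @ L2) g m k"
proof -
  let ?F = "\<lambda>s. comp_sum w L1 f s k" and ?G = "\<lambda>s. comp_sum w L2 g (m - s) k"
  let ?V = "weight w L1" and ?W = "\<lambda>s. weight w L2 (m - s)"
  have one: "unaffected (\<lambda>_. 1) i" for i :: 'a by (simp add: unaffected_def)
  have fg: "comp_sum w (L1 @ L2) (\<lambda>k. f k * g k) m k = (\<Sum>s\<le>m. ?F s * ?G s)"
    by (rule comp_sum_append) (use disj in auto)
  have f1: "comp_sum w (L1 @ L2) f m k = (\<Sum>s\<le>m. ?F s * ?W s)"
    using comp_sum_append[of L1 "\<lambda>_. 1" L2 f w m k] disj one by (simp add: comp_sum_const)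
  have g1: "comp_sum w (L1 @ L2) g m k = (\<Sum>s\<le>m. ?V s * ?G s)"
    using comp_sum_append[of L1 g L2 "\<lambda>_. 1" w m k] disj one by (simp add: comp_sum_const)
  have w1: "weight w (L1 @ L2) m = (\<Sum>s\<le>m. ?V s * ?W s)"
    using comp_sum_append[of L1 "\<lambda>_. 1" L2 "\<lambda>_. 1" w m k] one by (simp add: comp_sum_const)
  \<comment> \<open>The ratio of \<open>?F\<close> to \<open>?V\<close> increases in
    \<open>s\<close> and that of \<open>?G\<close> to \<open>?W\<close> decreases, so both minors
    are nonpositive.\<close>
  have "(\<Sum>s\<le>m. ?F s * ?G s) * (\<Sum>s\<le>m. ?V s * ?W s) \<le> (\<Sum>s\<le>m. ?F s * ?W s) * (\<Sum>s\<le>m. ?V s * ?G s)"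
  proof (rule cauchy_binet_le, simp, rule mult_nonpos_nonpos)
    fix i j :: nat assume "i \<le> j"
    show "?F i * ?V j - ?F j * ?V i \<le> 0"
      using comp_sum_weight_le[of L1 w f i j k] lc f \<open>i \<le> j\<close> by simp
    show "?W i * ?G j - ?W j * ?G i \<le> 0"
      using comp_sum_weight_le[of L2 w g "m - j" "m - i" k] lc g \<open>i \<le> j\<close>
      by (simp add: mult.commute diff_le_mono2)
  qed
  then show ?thesis by (simp only: fg f1 g1 w1)
qed

text \<open>Constraints on single counts move into the weights, so conditioning stays within product
  weights. By distinctness no later update overwrites the count that a factor \<open>c j\<close>
  refers to.\<close>

lemma comp_sum_restrict:
  assumes "distinct L"
  shows "comp_sum (\<lambda>i a. w i a * c i a) L f s k
       = comp_sum w L (\<lambda>k. f k * (\<Prod>i\<in>set L. c i (k i))) s k"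
  using assms
proof (induction L arbitrary: s k)
  case (Cons j L)
  have "comp_sum w L (\<lambda>k. f k * (\<Prod>i\<in>set (j # L). c i (k i))) r (k(j := a))
      = c j a * comp_sum w L (\<lambda>k. f k * (\<Prod>i\<in>set L. c i (k i))) r (k(j := a))" for r a
    using comp_sum_factor[of L "\<lambda>k. c j (k j)" w "\<lambda>k. f k * (\<Prod>i\<in>set L. c i (k i))" r "k(j := a)"] Cons.prems
    by (force simp: unaffected_def mult_ac)
  then show ?case using Cons by (simp add: mult_ac)
qed simp

subsection \<open>Occupancy counts and threshold events\<close>

lemma sum_Pow_card:
  fixes h :: "nat \<Rightarrow> real"
  assumes "finite S"
  shows "(\<Sum>T\<in>Pow S. h (card T)) = (\<Sum>a\<le>card S. real (card S choose a) * h a)"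
proof -
  have "(\<Sum>T\<in>Pow S. h (card T)) = (\<Sum>a\<le>card S. \<Sum>T\<in>{T\<in>Pow S. card T = a}. h (card T))"
    using assms by (intro sum.group[symmetric]) (auto intro: card_mono)
  also have "\<dots> = (\<Sum>a\<le>card S. real (card S choose a) * h a)"
    using n_subsets[OF assms] by (intro sum.cong) (simp_all add: Pow_def)
  finally show ?thesis .
qed

text \<open>
  The multinomial distribution of the occupancy counts, with \<open>fact (card S)\<close> taken out of the
  multinomial coefficient and the factors \<open>1 / fact a\<close> absorbed in the weights.
\<close>

lemma sum_PiE_counts:
  fixes p :: "'i \<Rightarrow> real" and S :: "'b set"
  assumes "finite S" "distinct L"
  shows "(\<Sum>\<tau>\<in>PiE S (\<lambda>_. set L). (\<Prod>i\<in>S. p (\<tau> i)) *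
            f (\<lambda>j. if j \<in> set L then card {i\<in>S. \<tau> i = j} else k j))
       = fact (card S) * comp_sum (\<lambda>j a. p j ^ a / fact a) L f (card S) k"
  using assms
proof (induction L arbitrary: S k)
  case Nil
  show ?case
  proof (cases "S = {}")
    case False
    then have "PiE S (\<lambda>_. set []) = ({} :: ('b \<Rightarrow> 'i) set)" by (auto simp: PiE_eq_empty_iff)
    then show ?thesis using False Nil by (simp add: card_eq_0_iff)
  qed simp
next
  case (Cons j L)
  let ?w = "\<lambda>j a. p j ^ a / fact a"
  define H where "H S k \<tau> = (\<Prod>i\<in>S. p (\<tau> i)) * f (\<lambda>j. if j \<in> set L then card {i\<in>S. \<tau> i = j} else k j)"
    for S :: "'b set" and k and \<tau> :: "'b \<Rightarrow> 'i"
  have "(\<Sum>\<tau>\<in>PiE S (\<lambda>_. set (j # L)). (\<Prod>i\<in>S. p (\<tau> i)) *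
            f (\<lambda>l. if l \<in> set (j # L) then card {i\<in>S. \<tau> i = l} else k l))
      = (\<Sum>(T, \<tau>)\<in>(SIGMA T:Pow S. PiE (S - T) (\<lambda>_. set L)). p j ^ card T * H (S - T) (k(j := card T)) \<tau>)"
  \<comment> \<open>A map is determined by its fibre \<open>T\<close> over \<open>j\<close> and its
    restriction to \<open>S - T\<close>, which avoids \<open>j\<close>.\<close>
  proof (rule sum.reindex_bij_witness[where
      j = "\<lambda>\<tau>. ({i\<in>S. \<tau> i = j}, restrict \<tau> (S - {i\<in>S. \<tau> i = j}))" and
      i = "\<lambda>(T, \<tau>). \<lambda>i\<in>S. if i \<in> T then j else \<tau> i"], goal_cases)
    case (1 \<tau>)
    then show ?case by (auto simp: fun_eq_iff PiE_def extensional_def)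
  next
    case (2 \<tau>)
    then show ?case by auto
  next
    case (3 T\<tau>)
    obtain T \<tau> where T\<tau>: "T\<tau> = (T, \<tau>)" by force
    have T: "T \<subseteq> S" and \<tau>: "\<tau> \<in> PiE (S - T) (\<lambda>_. set L)" using 3 T\<tau> by auto
    have "\<tau> i \<noteq> j" if "i \<in> S - T" for i using \<tau> that Cons.prems(2) by (auto simp: PiE_def Pi_def)
    then have "{i\<in>S. (\<lambda>i\<in>S. if i \<in> T then j else \<tau> i) i = j} = T" using T by auto
    moreover have "restrict (\<lambda>i\<in>S. if i \<in> T then j else \<tau> i) (S - T) = \<tau>"
      using \<tau> by (auto simp: fun_eq_iff PiE_def extensional_def)
    ultimately show ?case using T\<tau> by simp
  next
    case (4 T\<tau>)
    then show ?case by (auto simp: PiE_def Pi_def)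
  next
    case (5 \<tau>)
    define T where "T = {i\<in>S. \<tau> i = j}"
    have "T \<subseteq> S" by (auto simp: T_def)
    have "(\<Prod>i\<in>S. p (\<tau> i)) = (\<Prod>i\<in>T. p (\<tau> i)) * (\<Prod>i\<in>S - T. p (\<tau> i))"
      using prod.subset_diff[OF \<open>T \<subseteq> S\<close> \<open>finite S\<close>, of "\<lambda>i. p (\<tau> i)"] by (simp add: mult.commute)
    also have "(\<Prod>i\<in>T. p (\<tau> i)) = p j ^ card T" by (simp add: T_def)
    finally have prod: "(\<Prod>i\<in>S. p (\<tau> i)) = p j ^ card T * (\<Prod>i\<in>S - T. p (restrict \<tau> (S - T) i))"
      by simp
    have "card {i\<in>S - T. restrict \<tau> (S - T) i = l} = card {i\<in>S. \<tau> i = l}" if "l \<in> set L" for l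
      using that Cons.prems(2) by (intro arg_cong[where f = card]) (auto simp: T_def)
    then have "(\<lambda>l. if l \<in> set L then card {i\<in>S - T. restrict \<tau> (S - T) i = l} else (k(j := card T)) l)
        = (\<lambda>l. if l \<in> set L then card {i\<in>S. \<tau> i = l} else (k(j := card T)) l)"
      by (simp only: cong: if_cong)
    also have "\<dots> = (\<lambda>l. if l \<in> set (j # L) then card {i\<in>S. \<tau> i = l} else k l)"
      using Cons.prems(2) by (auto simp: fun_eq_iff T_def)
    finally have "(\<lambda>l. if l \<in> set L then card {i\<in>S - T. restrict \<tau> (S - T) i = l} else (k(j := card T)) l)
        = (\<lambda>l. if l \<in> set (j # L) then card {i\<in>S. \<tau> i = l} else k l)"
      .
    then show ?case by (simp add: H_def prod flip: T_def)
  qed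
  also have "\<dots> = (\<Sum>T\<in>Pow S. p j ^ card T * (\<Sum>\<tau>\<in>PiE (S - T) (\<lambda>_. set L). H (S - T) (k(j := card T)) \<tau>))"
    using \<open>finite S\<close> by (subst sum.Sigma[symmetric]) (auto intro!: finite_PiE simp: sum_distrib_left)
  also have "\<dots> = (\<Sum>T\<in>Pow S. p j ^ card T * (fact (card S - card T) *
      comp_sum ?w L f (card S - card T) (k(j := card T))))"
  proof (intro sum.cong refl arg_cong2[where f = "(*)"])
    fix T assume "T \<in> Pow S"
    then have "card (S - T) = card S - card T" "finite (S - T)"
      using \<open>finite S\<close> by (auto intro: card_Diff_subset finite_subset)
    then show "(\<Sum>\<tau>\<in>PiE (S - T) (\<lambda>_. set L). H (S - T) (k(j := card T)) \<tau>)
        = fact (card S - card T) * comp_sum ?w L f (card S - card T) (k(j := card T))"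
      using Cons.IH[of "S - T" "k(j := card T)"] Cons.prems by (simp add: H_def del: fun_upd_apply)
  qed
  also have "\<dots> = (\<Sum>a\<le>card S. real (card S choose a) * (p j ^ a * (fact (card S - a) *
      comp_sum ?w L f (card S - a) (k(j := a)))))"
    by (rule sum_Pow_card[OF \<open>finite S\<close>])
  \<comment> \<open>The binomial coefficient times \<open>fact (card S - a)\<close> is
    \<open>fact (card S) / fact a\<close>, whose denominator completes the weight of
    \<open>j\<close>.\<close>
  also have "\<dots> = fact (card S) * comp_sum ?w (j # L) f (card S) k"
    by (simp add: sum_distrib_left binomial_fact mult_ac)
  finally show ?case .
qed

section \<open>Threshold indicators as functions of the counts\<close>

definition threshold :: "'i set \<Rightarrow> ('i \<Rightarrow> nat) \<Rightarrow> ('i \<Rightarrow> nat) \<Rightarrow> 'i \<Rightarrow> nat" where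
  "threshold I t k = (\<lambda>j\<in>I. of_bool (t j \<le> k j))"

definition threshold_event ::
    "'i set \<Rightarrow> ('i \<Rightarrow> nat) \<Rightarrow> ('i \<Rightarrow> nat) set \<Rightarrow> ('i \<Rightarrow> nat) \<Rightarrow> real" where
  "threshold_event I t E k = of_bool (threshold I t k \<in> E)"

lemma threshold_in_PiE: "threshold I t k \<in> PiE I (\<lambda>_. {0, 1})"
  by (auto simp: threshold_def)

lemma mono_threshold_event:
  assumes "increasing_event I (\<lambda>_. {0, 1}) A"
  shows "mono (threshold_event I t A)"
proof (rule monoI)
  fix k k' :: "'a \<Rightarrow> nat" assume "k \<le> k'"
  then have "threshold I t k i \<le> threshold I t k' i" for i
    by (auto simp: threshold_def le_fun_def intro: order_trans)
  moreover have "\<forall>x\<in>PiE I (\<lambda>_. {0, 1}). \<forall>y\<in>A. (\<forall>i\<in>I. y i \<le> x i) \<longrightarrow> x \<in> A"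
    using assms by (simp add: increasing_event_def)
  note this[rule_format, OF threshold_in_PiE[of I t k'], of "threshold I t k"]
  ultimately show "threshold_event I t A k \<le> threshold_event I t A k'"
    by (auto simp: threshold_event_def)
qed

text \<open>Changing count \<open>i\<close> changes at most coordinate \<open>i\<close> of the
  threshold vector, and \<open>A\<close> does not separate such points.\<close>

lemma unaffected_threshold_event:
  assumes "\<not> affects I (\<lambda>_. {0, 1}) i A"
  shows "unaffected (threshold_event I t A) i"
  unfolding unaffected_def
proof (intro allI)
  fix k a
  have "threshold I t (k(i := a)) j = threshold I t k j" if "j \<in> I - {i}" for j
    using that by (simp add: threshold_def)
  moreover have "\<tau> \<in> A"
    if "\<eta> \<in> A" "\<tau> \<in> PiE I (\<lambda>_. {0, 1})" "\<forall>j\<in>I - {i}. \<eta> j = \<tau> j" for \<eta> \<tau>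
    using assms that unfolding affects_def by blast
  note this[OF _ threshold_in_PiE, of "threshold I t k" t "k(i := a)"]
    this[OF _ threshold_in_PiE, of "threshold I t (k(i := a))" t k]
  ultimately have "threshold I t (k(i := a)) \<in> A \<longleftrightarrow> threshold I t k \<in> A"
    by auto
  then show "threshold_event I t A (k(i := a)) = threshold_event I t A k"
    by (simp add: threshold_event_def)
qed

text \<open>The enumeration \<open>L\<close> is part of the conclusion because it depends on
  \<open>B\<close>: coordinates not affecting \<open>B\<close> come first, those affecting
  \<open>B\<close> last.\<close>

lemma threshold_events_neg_corr:
  fixes w :: "'i \<Rightarrow> nat \<Rightarrow> real" and v :: "'i \<Rightarrow> nat"
  assumes "finite I" "S \<subseteq> I" and lc: "\<And>i. i \<in> I \<Longrightarrow> log_concave (w i)"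
    and A: "increasing_event I (\<lambda>_. {0, 1}) A" and B: "increasing_event I (\<lambda>_. {0, 1}) B"
    and perp: "perp I (\<lambda>_. {0, 1}) A B"
  defines "C \<equiv> {x \<in> PiE I (\<lambda>_. {0, 1}). \<forall>i\<in>S. x i = v i}"
  obtains L where "distinct L" "set L = I"
    "comp_sum w L (threshold_event I t (C \<inter> (A \<inter> B))) m k * comp_sum w L (threshold_event I t C) m k
     \<le> comp_sum w L (threshold_event I t (C \<inter> A)) m k * comp_sum w L (threshold_event I t (C \<inter> B)) m k"
proof -
  obtain L1 where L1: "set L1 = {i\<in>I. \<not> affects I (\<lambda>_. {0, 1}) i B}" "distinct L1"
    using \<open>finite I\<close> finite_distinct_list[of "{i\<in>I. \<not> affects I (\<lambda>_. {0, 1}) i B}"] by auto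
  obtain L2 where L2: "set L2 = {i\<in>I. affects I (\<lambda>_. {0, 1}) i B}" "distinct L2"
    using \<open>finite I\<close> finite_distinct_list[of "{i\<in>I. affects I (\<lambda>_. {0, 1}) i B}"] by auto
  define L where "L = L1 @ L2"
  have L: "set L = I" "distinct L" using L1 L2 by (auto simp: L_def)
  \<comment> \<open>A prescribed indicator confines count \<open>i\<close> to
    \<open>a < t i\<close>, to \<open>t i \<le> a\<close>, or to the empty set if \<open>v i\<close>
    is neither 0 nor 1; each is order-convex.\<close>
  define Q where "Q i a \<longleftrightarrow> (i \<in> S \<longrightarrow> of_bool (t i \<le> a) = v i)" for i a
  define w' where "w' i a = w i a * of_bool (Q i a)" for i a
  have lc': "log_concave (w' i)" if "i \<in> set (L1 @ L2)" for i
    unfolding w'_def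
  proof (rule log_concave_restrict)
    show "log_concave (w i)" using lc L that by (simp add: L_def)
    show "Q i b" if "a \<le> b" "b \<le> c" "Q i a" "Q i c" for a b c
      using that by (auto simp: Q_def of_bool_def split: if_splits)
  qed
  have cond: "comp_sum w L (threshold_event I t (C \<inter> E)) m k = comp_sum w' L (threshold_event I t E) m k" for E
  proof -
    have "threshold_event I t (C \<inter> E) = (\<lambda>k. threshold_event I t E k * (\<Prod>i\<in>set L. of_bool (Q i (k i))))"
    proof
      fix k
      have "(\<Prod>i\<in>set L. of_bool (Q i (k i))) = (of_bool (\<forall>i\<in>I. Q i (k i)) :: real)"
        using \<open>finite I\<close> by (auto simp: L of_bool_def)
      moreover have "threshold I t k \<in> C \<longleftrightarrow> (\<forall>i\<in>I. Q i (k i))"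
        using \<open>S \<subseteq> I\<close> threshold_in_PiE[of I t k] by (auto simp: C_def Q_def threshold_def)
      ultimately show "threshold_event I t (C \<inter> E) k
          = threshold_event I t E k * (\<Prod>i\<in>set L. of_bool (Q i (k i)))"
        by (simp add: threshold_event_def)
    qed
    then show ?thesis unfolding w'_def by (simp add: comp_sum_restrict[OF L(2)])
  qed
  have "threshold_event I t UNIV = (\<lambda>_. 1)" by (simp add: threshold_event_def fun_eq_iff)
  then have condC: "comp_sum w L (threshold_event I t C) m k = weight w' L m"
    using cond[of UNIV] by (simp add: comp_sum_const)
  have condAB: "threshold_event I t (A \<inter> B) = (\<lambda>k. threshold_event I t A k * threshold_event I t B k)"
    by (simp add: threshold_event_def fun_eq_iff)
  have "comp_sum w' L (threshold_event I t (A \<inter> B)) m k * weight w' L m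
     \<le> comp_sum w' L (threshold_event I t A) m k * comp_sum w' L (threshold_event I t B) m k"
    unfolding condAB L_def
  proof (rule comp_sum_neg_corr[OF lc'])
    show "unaffected (threshold_event I t B) i" if "i \<in> set L1" for i
      using that L1 by (simp add: unaffected_threshold_event)
    show "unaffected (threshold_event I t A) i" if "i \<in> set L2" for i
      using that L2 perp by (auto simp: perp_def intro: unaffected_threshold_event)
  qed (use A B in \<open>simp_all add: mono_threshold_event, simp_all add: threshold_event_def\<close>)
  then show ?thesis
    using that[OF L(2,1)] by (simp only: cond condC)
qed

section \<open>The law of the occupancy counts\<close>

text \<open>The event is a finite disjoint union of cylinders \<open>D \<tau>\<close>, whose
  probabilities are products by independence. As \<open>E\<close> looks only at counts in
  \<open>{1..n}\<close>, the default \<open>k0\<close> elsewhere is arbitrary.\<close>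

lemma (in prob_space) prob_counts:
  fixes \<sigma> :: "nat \<Rightarrow> 'a \<Rightarrow> nat" and m n :: nat
  assumes "m > 0"
    and indep: "indep_vars (\<lambda>_. count_space {1..n}) \<sigma> {1..m}"
    and ident: "\<And>i l. i \<in> {1..m} \<Longrightarrow> l \<in> {1..n} \<Longrightarrow> prob (\<sigma> i -` {l} \<inter> space M) = p l"
    and L: "distinct L" "set L = {1..n}"
    and E: "\<And>k k'. (\<And>j. j \<in> {1..n} \<Longrightarrow> k j = k' j) \<Longrightarrow> E k \<longleftrightarrow> E k'"
  shows "{\<omega> \<in> space M. E (\<lambda>j. card {i\<in>{1..m}. \<sigma> i \<omega> = j})} \<in> events" (is "?X \<in> _")
    and "prob {\<omega> \<in> space M. E (\<lambda>j. card {i\<in>{1..m}. \<sigma> i \<omega> = j})}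
      = fact m * comp_sum (\<lambda>j a. p j ^ a / fact a) L (\<lambda>k. of_bool (E k)) m k0"
proof -
  have meas: "\<sigma> i \<in> M \<rightarrow>\<^sub>M count_space {1..n}" if "i \<in> {1..m}" for i
    using indep that by (simp add: indep_vars_def2)
  define T where "T = PiE {1..m} (\<lambda>_. {1..n})"
  define D where "D \<tau> = (\<Inter>i\<in>{1..m}. \<sigma> i -` {\<tau> i} \<inter> space M)" for \<tau>
  define U where "U = {\<tau>\<in>T. E (\<lambda>j. card {i\<in>{1..m}. \<tau> i = j})}"
  have "finite T" by (simp add: T_def finite_PiE)
  have \<tau>T: "\<tau> i \<in> {1..n}" if "\<tau> \<in> T" "i \<in> {1..m}" for \<tau> i
    using that by (auto simp: T_def)
  have D_events: "D \<tau> \<in> events" if "\<tau> \<in> T" for \<tau>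
    unfolding D_def using \<open>m > 0\<close> that
    by (intro sets.finite_INT measurable_sets[OF meas]) (auto dest: \<tau>T)
  have D_prob: "prob (D \<tau>) = (\<Prod>i\<in>{1..m}. p (\<tau> i))" if "\<tau> \<in> T" for \<tau>
  proof -
    have "prob (D \<tau>) = (\<Prod>i\<in>{1..m}. prob (\<sigma> i -` {\<tau> i} \<inter> space M))"
      unfolding D_def using \<open>m > 0\<close> \<tau>T[OF that] by (intro indep_varsD_finite[OF indep]) auto
    also have "\<dots> = (\<Prod>i\<in>{1..m}. p (\<tau> i))"
      using \<tau>T[OF that] by (intro prod.cong refl ident)
    finally show ?thesis .
  qed
  have X_eq: "?X = (\<Union>\<tau>\<in>U. D \<tau>)"
  proof (intro equalityI subsetI)
    fix \<omega> assume \<omega>: "\<omega> \<in> ?X"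
    define \<tau> where "\<tau> = (\<lambda>i\<in>{1..m}. \<sigma> i \<omega>)"
    have "\<tau> \<in> T"
      using measurable_space[OF meas] \<omega> by (auto simp: T_def \<tau>_def)
    moreover have "\<omega> \<in> D \<tau>" using \<omega> \<open>m > 0\<close> by (auto simp: D_def \<tau>_def)
    moreover have "{i\<in>{1..m}. \<tau> i = j} = {i\<in>{1..m}. \<sigma> i \<omega> = j}" for j by (auto simp: \<tau>_def)
    ultimately show "\<omega> \<in> (\<Union>\<tau>\<in>U. D \<tau>)" using \<omega> by (auto simp: U_def)
  next
    fix \<omega> assume "\<omega> \<in> (\<Union>\<tau>\<in>U. D \<tau>)"
    then obtain \<tau> where \<tau>: "\<tau> \<in> U" "\<omega> \<in> D \<tau>" by blast
    then have "\<And>i. i \<in> {1..m} \<Longrightarrow> \<sigma> i \<omega> = \<tau> i" "\<omega> \<in> space M"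
      using \<open>m > 0\<close> by (auto simp: D_def)
    moreover from this have "{i\<in>{1..m}. \<tau> i = j} = {i\<in>{1..m}. \<sigma> i \<omega> = j}" for j by auto
    ultimately show "\<omega> \<in> ?X" using \<tau> by (simp add: U_def)
  qed
  have "finite U" "U \<subseteq> T" using \<open>finite T\<close> by (auto simp: U_def)
  then show "?X \<in> events"
    unfolding X_eq using D_events by (intro sets.finite_UN) auto
  have disj: "disjoint_family_on D U"
  proof (unfold disjoint_family_on_def, intro ballI impI, rule ccontr)
    fix \<tau> \<tau>' assume *: "\<tau> \<in> U" "\<tau>' \<in> U" "\<tau> \<noteq> \<tau>'" "D \<tau> \<inter> D \<tau>' \<noteq> {}"
    then have "\<tau> i = \<tau>' i" if "i \<in> {1..m}" for i using that by (auto simp: D_def)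
    then have "\<tau> = \<tau>'" using * \<open>U \<subseteq> T\<close> unfolding T_def
      by (intro PiE_ext[of \<tau> "{1..m}" "\<lambda>_. {1..n}" \<tau>']) auto
    then show False using * by simp
  qed
  have "prob ?X = (\<Sum>\<tau>\<in>U. prob (D \<tau>))"
    unfolding X_eq using \<open>finite U\<close> \<open>U \<subseteq> T\<close> D_events disj
    by (intro finite_measure_finite_Union) auto
  also have "\<dots> = (\<Sum>\<tau>\<in>U. \<Prod>i\<in>{1..m}. p (\<tau> i))"
    using \<open>U \<subseteq> T\<close> by (intro sum.cong refl D_prob) auto
  also have "\<dots> = (\<Sum>\<tau>\<in>T. (\<Prod>i\<in>{1..m}. p (\<tau> i)) *
      of_bool (E (\<lambda>j. if j \<in> set L then card {i\<in>{1..m}. \<tau> i = j} else k0 j)))"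
  \<comment> \<open>The indicator of \<open>E\<close> extends the sum from \<open>U\<close> to all
    maps in \<open>T\<close>.\<close>
  proof (rule sum.mono_neutral_cong_left)
    have E_eq: "E (\<lambda>j. if j \<in> set L then card {i\<in>{1..m}. \<tau> i = j} else k0 j)
        \<longleftrightarrow> E (\<lambda>j. card {i\<in>{1..m}. \<tau> i = j})" for \<tau> :: "nat \<Rightarrow> nat"
      by (rule E) (simp add: L)
    show "\<forall>\<tau>\<in>T - U. (\<Prod>i\<in>{1..m}. p (\<tau> i)) *
      of_bool (E (\<lambda>j. if j \<in> set L then card {i\<in>{1..m}. \<tau> i = j} else k0 j)) = 0"
      by (simp only: E_eq) (auto simp: U_def)
    show "(\<Prod>i\<in>{1..m}. p (\<tau> i)) = (\<Prod>i\<in>{1..m}. p (\<tau> i)) *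
      of_bool (E (\<lambda>j. if j \<in> set L then card {i\<in>{1..m}. \<tau> i = j} else k0 j))" if "\<tau> \<in> U" for \<tau>
      using that by (simp only: E_eq) (auto simp: U_def)
  qed (use \<open>finite T\<close> \<open>U \<subseteq> T\<close> in auto)
  also have "\<dots> = fact m * comp_sum (\<lambda>j a. p j ^ a / fact a) L (\<lambda>k. of_bool (E k)) m k0"
    using sum_PiE_counts[of "{1..m}" L p "\<lambda>k. of_bool (E k)" k0] L by (simp add: T_def)
  finally show "prob ?X = fact m * comp_sum (\<lambda>j a. p j ^ a / fact a) L (\<lambda>k. of_bool (E k)) m k0" .
qed

section \<open>Conditional negative association of the threshold indicators\<close>

theorem theorem1:
  fixes M :: "'w measure" and m n :: nat
    and \<sigma> :: "nat \<Rightarrow> 'w \<Rightarrow> nat" and t :: "nat \<Rightarrow> nat"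
    and x :: "nat \<Rightarrow> 'w \<Rightarrow> nat"
  assumes "m > 0" and "n > 0"
    and "prob_space M"
    and indep: "prob_space.indep_vars M (\<lambda>_. count_space {1..n}) \<sigma> {1..m}"
    and ident: "\<And>i i'. i \<in> {1..m} \<Longrightarrow> i' \<in> {1..m} \<Longrightarrow>
      distr M (count_space {1..n}) (\<sigma> i) = distr M (count_space {1..n}) (\<sigma> i')"
    and x_def: "\<And>j. j \<in> {1..n} \<Longrightarrow>
      x j = indicator {\<omega> \<in> space M. card {i \<in> {1..m}. \<sigma> i \<omega> = j} \<ge> t j}"
  shows "conditionally_negatively_associated {1..n} (\<lambda>_. {0, 1})
    (distr M (count_space (PiE {1..n} (\<lambda>_. {0, 1}))) (\<lambda>\<omega>. \<lambda>j\<in>{1..n}. x j \<omega>))"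
proof -
  interpret prob_space M by fact
  let ?I = "{1..n}"
  let ?\<Omega> = "PiE ?I (\<lambda>_. {0, 1::nat})"
  let ?X = "\<lambda>\<omega>. \<lambda>j\<in>?I. x j \<omega>"
  define \<mu> where "\<mu> = distr M (count_space ?\<Omega>) ?X"
  \<comment> \<open>As \<open>m > 0\<close>, the index 1 is available to represent the common
    law.\<close>
  define p where "p l = prob (\<sigma> 1 -` {l} \<inter> space M)" for l
  define w where "w j a = p j ^ a / fact a" for j a
  have p: "prob (\<sigma> i -` {l} \<inter> space M) = p l" if "i \<in> {1..m}" "l \<in> ?I" for i l
  proof -
    have "\<sigma> i' \<in> M \<rightarrow>\<^sub>M count_space ?I" if "i' \<in> {1..m}" for i'
      using indep that by (simp add: indep_vars_def2)
    then have "prob (\<sigma> i' -` {l} \<inter> space M) = measure (distr M (count_space ?I) (\<sigma> i')) {l}"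
      if "i' \<in> {1..m}" for i'
      using that \<open>l \<in> ?I\<close> by (simp add: measure_distr)
    then show ?thesis using that ident[of i 1] \<open>m > 0\<close> by (simp add: p_def)
  qed
  have lc: "log_concave (w i)" for i
    unfolding w_def by (rule log_concave_exp_weight) (simp add: p_def)
  have X: "?X \<omega> = threshold ?I t (\<lambda>j. card {i\<in>{1..m}. \<sigma> i \<omega> = j})" if "\<omega> \<in> space M" for \<omega>
    using that by (auto simp: threshold_def x_def fun_eq_iff)
  \<comment> \<open>The vectors are compared only on \<open>space M\<close>, outside of which the
    indicators \<open>x j\<close> are 0.\<close>
  have preimage: "?X -` E \<inter> space M
      = {\<omega> \<in> space M. threshold ?I t (\<lambda>j. card {i\<in>{1..m}. \<sigma> i \<omega> = j}) \<in> E}" for E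
  proof (rule set_eqI)
    fix \<omega>
    show "\<omega> \<in> ?X -` E \<inter> space M
      \<longleftrightarrow> \<omega> \<in> {\<omega> \<in> space M. threshold ?I t (\<lambda>j. card {i\<in>{1..m}. \<sigma> i \<omega> = j}) \<in> E}"
      by (cases "\<omega> \<in> space M") (simp_all only: vimage_eq Int_iff mem_Collect_eq X simp_thms)
  qed
  have threshold_cong: "threshold ?I t k \<in> E \<longleftrightarrow> threshold ?I t k' \<in> E"
    if "\<And>j. j \<in> ?I \<Longrightarrow> k j = k' j" for k k' E
  proof -
    have "threshold ?I t k = threshold ?I t k'"
      unfolding threshold_def by (rule restrict_ext) (simp add: that)
    then show ?thesis by simp
  qed
  obtain L0 where L0: "distinct L0" "set L0 = ?I" using finite_distinct_list[of ?I] by auto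
  have X_meas: "?X \<in> M \<rightarrow>\<^sub>M count_space ?\<Omega>"
  proof (rule measurableI)
    show "?X \<omega> \<in> space (count_space ?\<Omega>)" if "\<omega> \<in> space M" for \<omega>
      using X[OF that] threshold_in_PiE[of ?I t] by simp
    show "?X -` E \<inter> space M \<in> events" for E
      unfolding preimage
      by (rule prob_counts(1)[OF \<open>m > 0\<close> indep p L0]) (assumption+, rule threshold_cong, simp)
  qed
  \<comment> \<open>This holds for every enumeration \<open>L\<close>, so the one depending on
    \<open>B\<close> can be used below.\<close>
  have \<mu>_measure: "measure \<mu> E = fact m * comp_sum w L (threshold_event ?I t E) m (\<lambda>_. 0)"
    if "E \<subseteq> ?\<Omega>" "distinct L" "set L = ?I" for E L
  proof -
    have "measure \<mu> E = prob (?X -` E \<inter> space M)"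
      unfolding \<mu>_def using that by (intro measure_distr[OF X_meas]) simp
    also have "\<dots> = fact m * comp_sum w L (threshold_event ?I t E) m (\<lambda>_. 0)"
      unfolding preimage w_def threshold_event_def[abs_def]
      by (rule prob_counts(2)[OF \<open>m > 0\<close> indep p that(2,3)]) (assumption+, rule threshold_cong, simp)
    finally show ?thesis .
  qed
  interpret \<mu>: prob_space \<mu>
    unfolding \<mu>_def by (rule prob_space_distr[OF X_meas])
  have sets_\<mu>: "sets \<mu> = Pow ?\<Omega>" by (simp add: \<mu>_def)
  have neg_assoc: "negatively_associated ?I (\<lambda>_. {0, 1}) (uniform_measure \<mu> {x \<in> ?\<Omega>. \<forall>i\<in>S. x i = v i})"
    if "S \<subseteq> ?I" and pos: "measure \<mu> {x \<in> ?\<Omega>. \<forall>i\<in>S. x i = v i} > 0" for S v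
  proof -
    define C where "C = {x \<in> ?\<Omega>. \<forall>i\<in>S. x i = v i}"
    have C: "C \<subseteq> ?\<Omega>" "measure \<mu> C > 0" using pos by (auto simp: C_def)
    then have C_emeasure: "emeasure \<mu> C \<noteq> 0" "emeasure \<mu> C \<noteq> \<infinity>"
      by (auto simp: measure_def)
    have neg_corr: "measure (uniform_measure \<mu> C) (A \<inter> B)
        \<le> measure (uniform_measure \<mu> C) A * measure (uniform_measure \<mu> C) B"
      if A: "increasing_event ?I (\<lambda>_. {0, 1}) A" and B: "increasing_event ?I (\<lambda>_. {0, 1}) B"
        and perp: "perp ?I (\<lambda>_. {0, 1}) A B" for A B
    proof -
      have sub: "A \<subseteq> ?\<Omega>" "B \<subseteq> ?\<Omega>" using A B by (auto simp: increasing_event_def)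
      obtain L where L: "distinct L" "set L = ?I"
        and le: "comp_sum w L (threshold_event ?I t (C \<inter> (A \<inter> B))) m (\<lambda>_. 0) *
            comp_sum w L (threshold_event ?I t C) m (\<lambda>_. 0)
          \<le> comp_sum w L (threshold_event ?I t (C \<inter> A)) m (\<lambda>_. 0) *
            comp_sum w L (threshold_event ?I t (C \<inter> B)) m (\<lambda>_. 0)"
        by (rule threshold_events_neg_corr[OF finite_atLeastAtMost \<open>S \<subseteq> ?I\<close> lc A B perp,
              where v = v and t = t and m = m and k = "\<lambda>_. 0", folded C_def])
      have \<mu>_eq: "measure \<mu> (C \<inter> E) = fact m * comp_sum w L (threshold_event ?I t (C \<inter> E)) m (\<lambda>_. 0)" for E
        by (intro \<mu>_measure L le_infI1 C)
      have "measure \<mu> (C \<inter> (A \<inter> B)) * measure \<mu> C \<le> measure \<mu> (C \<inter> A) * measure \<mu> (C \<inter> B)"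
        using mult_left_mono[OF le, of "fact m * fact m"] \<mu>_eq[of UNIV] by (simp add: \<mu>_eq mult_ac)
      \<comment> \<open>Division by the square of \<open>measure \<mu> C\<close> turns this into the
        inequality for the conditioned measure.\<close>
      then show ?thesis
        using C sub by (simp add: C_emeasure sets_\<mu> le_infI1 field_simps)
    qed
    have "prob_measure_on ?\<Omega> (uniform_measure \<mu> C)"
      using C_emeasure by (simp add: prob_measure_on_def prob_space_uniform_measure sets_\<mu>)
    then show ?thesis
      unfolding negatively_associated_def C_def[symmetric]
      by (intro conjI allI impI) (assumption, elim conjE, rule neg_corr)
  qed
  have "prob_measure_on ?\<Omega> \<mu>"
    by (simp add: prob_measure_on_def \<mu>.prob_space_axioms sets_\<mu>)
  then show ?thesis
    unfolding conditionally_negatively_associated_def \<mu>_def[symmetric]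
    by (intro conjI allI impI) (assumption, elim conjE, rule neg_assoc)
qed

end
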